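(* Let $x_0$ be an irrational real number, and let $(x_k)_{k\ge 0}$, $(q_k)_{k\ge 0}$, $(s_k)_{k\ge 0}$, $(t_k)_{k\ge 0}$ be the sequences produced by the extended Euclidean algorithm with input $a=x_0$, $b=1$ (defined in the context). To each natural number $n\ge 2$ assign the unique index $j\in\mathbb{N}$ with $t_j<n\le t_{j+1}$; to $n=1$ assign the index $j=1$. Put $$s_{n,j+1}:=s_{j-1}+s_j\left\lfloor\frac{n-t_{j-1}}{t_j}\right\rfloor,\qquad t_{n,j+1}:=t_{j-1}+t_j\left\lfloor\frac{n-t_{j-1}}{t_j}\right\rfloor .$$ Then for every $n\in\mathbb{N}$ with assigned index $j$: (1) If $j$ is odd, then $\frac{s_j}{t_j}<x_0<\frac{s_{n,j+1}}{t_{n,j+1}}$, and the reduced fractions $\frac{s_j}{t_j}<\frac{s_{n,j+1}}{t_{n,j+1}}$ are neighbours (consecutive) in the extended Farey sequence $\mathcal{F}_n^{ext}$. (2) If $j$ is even, then $\frac{s_{n,j+1}}{t_{n,j+1}}<x_0<\frac{s_j}{t_j}$, and the reduced fractions $\frac{s_{n,j+1}}{t_{n,j+1}}<\frac{s_j}{t_j}$ are neighbours (consecutive) in $\mathcal{F}_n^{ext}$.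
   Context: $\mathbb{N}=\{1,2,3,\dots\}$. For $n\in\mathbb{N}$ the extended Farey sequence $\mathcal{F}_n^{ext}$ consists of all reduced fractions $\frac{a}{b}$ with $a\in\mathbb{Z}$, $b\in\mathbb{N}$, $\gcd(a,b)=1$ and $b\le n$, sorted in increasing order; two of its members are neighbours if no other member lies strictly between them. Extended Euclidean algorithm for irrational $x_0$ (input $a=x_0$, $b=1$): $q_k=\lfloor x_k\rfloor$ for $k\ge 0$, and $x_k=\frac{1}{x_{k-1}-q_{k-1}}$ for $k\ge 1$; $s_0=1$, $s_1=q_0$, $t_0=0$, $t_1=1$; and for $k\ge 1$: $s_{k+1}=s_{k-1}+q_k s_k$, $t_{k+1}=t_{k-1}+q_k t_k$. *)

theory Defs
  imports Complex_Main
begin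

definition reduced_fraction :: "int \<Rightarrow> int \<Rightarrow> bool" where
  "reduced_fraction a b \<longleftrightarrow> 1 \<le> b \<and> coprime a b"

text \<open>The members of the extended Farey sequence are represented by their values as real numbers;
  the increasing order of the sequence is then the usual order on the reals.\<close>

definition farey_ext :: "nat \<Rightarrow> real set" where
  "farey_ext n = {of_int a / of_int b |a b. reduced_fraction a b \<and> b \<le> int n}"

text \<open>The smaller fraction is the first argument.\<close>

definition farey_neighbours :: "nat \<Rightarrow> real \<Rightarrow> real \<Rightarrow> bool" where
  "farey_neighbours n p r \<longleftrightarrow>
     p \<in> farey_ext n \<and> r \<in> farey_ext n \<and> p < r \<and> \<not> (\<exists>y\<in>farey_ext n. p < y \<and> y < r)"

text \<open>In the following, the argument \<open>x0\<close> is the input of the extended Euclidean algorithm. The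
  recursion for \<open>eea_x\<close> never divides by zero if \<open>x0\<close> is irrational.\<close>

fun eea_x :: "real \<Rightarrow> nat \<Rightarrow> real" where
  "eea_x x0 0 = x0"
| "eea_x x0 (Suc k) = 1 / (eea_x x0 k - of_int \<lfloor>eea_x x0 k\<rfloor>)"

definition eea_q :: "real \<Rightarrow> nat \<Rightarrow> int" where
  "eea_q x0 k = \<lfloor>eea_x x0 k\<rfloor>"

fun eea_s :: "real \<Rightarrow> nat \<Rightarrow> int" where
  "eea_s x0 0 = 1"
| "eea_s x0 (Suc 0) = eea_q x0 0"
| "eea_s x0 (Suc (Suc k)) = eea_s x0 k + eea_q x0 (Suc k) * eea_s x0 (Suc k)"

fun eea_t :: "real \<Rightarrow> nat \<Rightarrow> int" where
  "eea_t x0 0 = 0"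
| "eea_t x0 (Suc 0) = 1"
| "eea_t x0 (Suc (Suc k)) = eea_t x0 k + eea_q x0 (Suc k) * eea_t x0 (Suc k)"

definition is_bracket_index :: "real \<Rightarrow> nat \<Rightarrow> nat \<Rightarrow> bool" where
  "is_bracket_index x0 n j \<longleftrightarrow> 1 \<le> j \<and> eea_t x0 j < int n \<and> int n \<le> eea_t x0 (j + 1)"

definition assigned_index :: "real \<Rightarrow> nat \<Rightarrow> nat" where
  "assigned_index x0 n = (if n = 1 then 1 else THE j. is_bracket_index x0 n j)"

text \<open>\<open>inter_s x0 n j\<close> and \<open>inter_t x0 n j\<close> have the index \<open>n, j+1\<close> in the usual notation. They are
  only meant for \<open>j \<ge> 1\<close>, since \<open>j - 1\<close> is truncated at \<open>0\<close>.\<close>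

definition eea_step :: "real \<Rightarrow> nat \<Rightarrow> nat \<Rightarrow> int" where
  "eea_step x0 n j =
     \<lfloor>(real n - real_of_int (eea_t x0 (j - 1))) / real_of_int (eea_t x0 j)\<rfloor>"

definition inter_s :: "real \<Rightarrow> nat \<Rightarrow> nat \<Rightarrow> int" where
  "inter_s x0 n j = eea_s x0 (j - 1) + eea_s x0 j * eea_step x0 n j"

definition inter_t :: "real \<Rightarrow> nat \<Rightarrow> nat \<Rightarrow> int" where
  "inter_t x0 n j = eea_t x0 (j - 1) + eea_t x0 j * eea_step x0 n j"

end

(* The errors (-1)^k (s_k - t_k x0) are positive and satisfy err_k = x_(k+1) err_(k+1), so s_k/t_k lies
   alternately below and above x0. Since s_(n,j+1), t_(n,j+1) arise from s_(j-1), t_(j-1) by adding m times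
   s_j, t_j with m at most q_j, the error keeps the sign it has at index j+1, and the determinant with
   s_j, t_j stays that of consecutive convergents, +1 or -1. Two fractions with determinant 1 are
   neighbours in the Farey sequence of order n as soon as their denominators sum to more than n, and m is
   the largest choice with t_(n,j+1) <= n. *)
theory Submission
  imports Defs
begin

lemma reduced_fraction_of_det:
  fixes p b r d :: int
  assumes "r * b - p * d = 1" "1 \<le> b" "1 \<le> d"
  shows "reduced_fraction p b" and "reduced_fraction r d"
proof -
  have "coprime p b"
  proof (rule coprimeI)
    fix c assume "c dvd p" "c dvd b"
    then have "c dvd r * b - p * d" by simp
    then show "is_unit c" using assms by simp
  qed
  moreover have "coprime r d"
  proof (rule coprimeI)
    fix c assume "c dvd r" "c dvd d"
    then have "c dvd r * b - p * d" by simp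
    then show "is_unit c" using assms by simp
  qed
  ultimately show "reduced_fraction p b" "reduced_fraction r d"
    using assms by (simp_all add: reduced_fraction_def)
qed

text \<open>If \<open>u / v\<close> lay strictly between, \<open>u * b - p * v\<close> and
  \<open>r * v - u * d\<close> would be positive integers. Weighted with \<open>d\<close> and
  \<open>b\<close> they add up to \<open>v\<close> times the determinant, so \<open>v\<close> would
  be at least \<open>b + d\<close>, hence larger than \<open>n\<close>.\<close>

lemma farey_neighbours_of_det:
  fixes p b r d :: int and n :: nat
  assumes det: "r * b - p * d = 1"
    and b: "1 \<le> b" "b \<le> int n" and d: "1 \<le> d" "d \<le> int n"
    and sum: "int n < b + d"
  shows "farey_neighbours n (of_int p / of_int b) (of_int r / of_int d)"
proof -
  have less_iff: "(of_int u / of_int v :: real) < of_int u' / of_int v' \<longleftrightarrow> u * v' < u' * v"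
    if "1 \<le> v" "1 \<le> v'" for u v u' v' :: int
  proof -
    have "(of_int u / of_int v :: real) < of_int u' / of_int v'
        \<longleftrightarrow> of_int (u * v') < (of_int (u' * v) :: real)"
      using that by (simp add: divide_simps mult.commute)
    then show ?thesis unfolding of_int_less_iff .
  qed
  have False
    if y: "y \<in> farey_ext n" "of_int p / of_int b < y" "y < of_int r / of_int d" for y
  proof -
    obtain u v where uv: "y = of_int u / of_int v" "1 \<le> v" "v \<le> int n"
      using y(1) by (auto simp: farey_ext_def reduced_fraction_def)
    have 1: "1 \<le> u * b - p * v" using y(2) uv less_iff[of b v p u] b by simp
    have 2: "1 \<le> r * v - u * d" using y(3) uv less_iff[of v d u r] d by simp
    have "v = v * (r * b - p * d)" using det by simp
    also have "\<dots> = b * (r * v - u * d) + d * (u * b - p * v)" by (simp add: algebra_simps)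
    also have "\<dots> \<ge> b * 1 + d * 1"
      using 1 2 b(1) d(1) by (intro add_mono mult_left_mono) auto
    finally show False using uv(3) sum by simp
  qed
  moreover have "(of_int p / of_int b :: real) < of_int r / of_int d"
    using det b d by (subst less_iff) auto
  ultimately show ?thesis
    using reduced_fraction_of_det[OF det b(1) d(1)] b(2) d(2)
    unfolding farey_neighbours_def farey_ext_def by blast
qed

lemma eea_x_irrational:
  assumes "x0 \<notin> \<rat>"
  shows "eea_x x0 k \<notin> \<rat>"
proof (induction k)
  case (Suc k)
  show ?case
  proof
    assume "eea_x x0 (Suc k) \<in> \<rat>"
    \<comment> \<open>This sum is \<open>eea_x x0 k\<close>: the recursion solved for its previous
      term.\<close>
    then have "1 / eea_x x0 (Suc k) + of_int \<lfloor>eea_x x0 k\<rfloor> \<in> \<rat>" by (intro Rats_add Rats_divide) auto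
    then show False using Suc by simp
  qed
qed (use assms in simp)

lemma eea_frac_pos:
  assumes "x0 \<notin> \<rat>"
  shows "0 < eea_x x0 k - of_int (eea_q x0 k)"
proof -
  have "eea_x x0 k \<noteq> of_int (eea_q x0 k)" using eea_x_irrational[OF assms] by (metis Rats_of_int)
  moreover have "of_int (eea_q x0 k) \<le> eea_x x0 k" by (simp add: eea_q_def)
  ultimately show ?thesis by linarith
qed

lemma eea_q_ge_1:
  assumes "x0 \<notin> \<rat>"
  shows "1 \<le> eea_q x0 (Suc k)"
proof -
  have "eea_x x0 k - of_int (eea_q x0 k) < 1" unfolding eea_q_def by linarith
  then have "1 \<le> eea_x x0 (Suc k)"
    using eea_frac_pos[OF assms, of k] by (simp add: eea_q_def)
  then show ?thesis by (simp add: eea_q_def le_floor_iff del: eea_x.simps)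
qed

lemma eea_t_bounds:
  assumes "x0 \<notin> \<rat>"
  shows "0 \<le> eea_t x0 k \<and> (k \<noteq> 0 \<longrightarrow> 1 \<le> eea_t x0 k) \<and> 1 \<le> eea_t x0 (Suc k) \<and> int k \<le> eea_t x0 (Suc k)
    \<and> eea_t x0 k \<le> eea_t x0 (Suc k)"
proof (induction k)
  case (Suc k)
  have "1 * eea_t x0 (Suc k) \<le> eea_q x0 (Suc k) * eea_t x0 (Suc k)"
    using Suc eea_q_ge_1[OF assms, of k] by (intro mult_right_mono) auto
  then have *: "eea_t x0 k + eea_t x0 (Suc k) \<le> eea_t x0 (Suc (Suc k))" by simp
  \<comment> \<open>For \<open>k = 0\<close> the new linear bound is just
    \<open>1 \<le> eea_t x0 (Suc k)\<close>; otherwise the summand \<open>eea_t x0 k \<ge> 1\<close>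
    raises the bound from \<open>k\<close> to \<open>k + 1\<close>.\<close>
  show ?case using Suc.IH * by (cases "k = 0") (simp_all del: eea_t.simps)
qed simp

lemma mono_eea_t:
  assumes "x0 \<notin> \<rat>"
  shows "mono (eea_t x0)"
  using eea_t_bounds[OF assms] by (simp add: mono_iff_le_Suc)

lemma eea_det: "eea_s x0 k * eea_t x0 (Suc k) - eea_s x0 (Suc k) * eea_t x0 k = (-1) ^ k"
proof (induction k)
  case (Suc k)
  have "eea_s x0 (Suc k) * eea_t x0 (Suc (Suc k)) - eea_s x0 (Suc (Suc k)) * eea_t x0 (Suc k)
      = - (eea_s x0 k * eea_t x0 (Suc k) - eea_s x0 (Suc k) * eea_t x0 k)"
    by (simp add: algebra_simps)
  then show ?case using Suc by simp
qed simp

text \<open>These are the successive remainders of the Euclidean algorithm on \<open>x0\<close> and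
  1, starting with 1 and \<open>x0 - q_0\<close>.\<close>

definition eea_err :: "real \<Rightarrow> nat \<Rightarrow> real" where
  "eea_err x0 k = (-1) ^ k * (of_int (eea_s x0 k) - of_int (eea_t x0 k) * x0)"

lemma eea_err_Suc_Suc:
  "eea_err x0 (Suc (Suc k)) = eea_err x0 k - of_int (eea_q x0 (Suc k)) * eea_err x0 (Suc k)"
  by (simp add: eea_err_def algebra_simps)

text \<open>The fractional part of \<open>x_k\<close> is the ratio of consecutive remainders. Its
  reciprocal is \<open>x_(k+1)\<close>, so the recurrence for the remainders carries the identity
  one index further. Positivity then passes along the sequence.\<close>

lemma eea_err_Suc:
  assumes "x0 \<notin> \<rat>"
  shows "eea_err x0 (Suc k) = (eea_x x0 k - of_int (eea_q x0 k)) * eea_err x0 k"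
proof (induction k)
  case (Suc k)
  have "eea_x x0 (Suc k) * eea_err x0 (Suc k) = eea_err x0 k"
    using Suc eea_frac_pos[OF assms, of k] by (simp add: eea_q_def)
  then show ?case by (simp add: eea_err_Suc_Suc algebra_simps del: eea_x.simps)
qed (simp add: eea_err_def)

lemma eea_err_pos:
  assumes "x0 \<notin> \<rat>"
  shows "0 < eea_err x0 k"
proof (induction k)
  case (Suc k)
  then show ?case using eea_err_Suc[OF assms] eea_frac_pos[OF assms] by simp
qed (simp add: eea_err_def)

text \<open>Existence comes from the growth of the denominators, uniqueness from their
  monotonicity.\<close>

lemma ex1_bracket_index:
  assumes "x0 \<notin> \<rat>" "2 \<le> n"
  shows "\<exists>!i. is_bracket_index x0 n i"
proof (rule ex_ex1I)
  define i where "i = (LEAST i. int n \<le> eea_t x0 (Suc i))"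
  have "int n \<le> eea_t x0 (Suc n)" using eea_t_bounds[OF assms(1), of n] by simp
  then have le: "int n \<le> eea_t x0 (Suc i)" unfolding i_def by (rule LeastI)
  \<comment> \<open>At \<open>i = 0\<close> the bound would read \<open>n \<le> 1\<close>.\<close>
  have "i \<noteq> 0" using le assms(2) by (cases i) auto
  then obtain l where l: "i = Suc l" by (cases i) auto
  then have "\<not> int n \<le> eea_t x0 (Suc l)" unfolding i_def by (metis lessI not_less_Least)
  then show "\<exists>i. is_bracket_index x0 n i"
    using le l by (intro exI[of _ i]) (simp add: is_bracket_index_def)
next
  fix i k
  assume ik: "is_bracket_index x0 n i" "is_bracket_index x0 n k"
  have "\<not> i' < k'" if "is_bracket_index x0 n i'" "is_bracket_index x0 n k'" for i' k'
  proof
    assume "i' < k'"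
    then have "eea_t x0 (i' + 1) \<le> eea_t x0 k'" using mono_eea_t[OF assms(1)] by (simp add: monoD)
    then show False using that by (simp add: is_bracket_index_def)
  qed
  then show "i = k" using ik by (meson linorder_neqE_nat)
qed

text \<open>For \<open>n = 1\<close> the assigned index satisfies the bracket only with \<open>\<le>\<close> on the left; this weak form
  is all that is needed.\<close>

lemma assigned_index_bounds:
  assumes "x0 \<notin> \<rat>" "1 \<le> n"
  obtains k where "assigned_index x0 n = Suc k" "eea_t x0 (Suc k) \<le> int n"
    "int n \<le> eea_t x0 (Suc (Suc k))"
proof (cases "n = 1")
  case True
  then show ?thesis using that[of 0] eea_t_bounds[OF assms(1), of 1] by (simp add: assigned_index_def)
next
  case False
  with assms(2) have n: "2 \<le> n" by simp
  have "is_bracket_index x0 n (assigned_index x0 n)"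
    using theI'[OF ex1_bracket_index[OF assms(1) n]] False by (simp add: assigned_index_def)
  then show ?thesis
    using that[of "assigned_index x0 n - 1"] by (simp add: is_bracket_index_def del: eea_t.simps)
qed

lemma eea_step_eq_div: "eea_step x0 n (Suc k) = (int n - eea_t x0 k) div eea_t x0 (Suc k)"
  unfolding eea_step_def floor_divide_of_int_eq[symmetric, where 'a = real] by simp

context
  fixes x0 :: real and n k :: nat
  assumes irr: "x0 \<notin> \<rat>"
    and bracket: "eea_t x0 (Suc k) \<le> int n" "int n \<le> eea_t x0 (Suc (Suc k))"
begin

text \<open>The denominator \<open>inter_t x0 n (Suc k)\<close> is the largest integer up to
  \<open>n\<close> that is congruent to \<open>eea_t x0 k\<close> modulo
  \<open>eea_t x0 (Suc k)\<close>.\<close>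

lemma inter_t_bounds:
  "inter_t x0 n (Suc k) \<le> int n" "int n < eea_t x0 (Suc k) + inter_t x0 n (Suc k)"
proof -
  define t where "t = eea_t x0 (Suc k)"
  define z where "z = int n - eea_t x0 k"
  have "0 < t" using eea_t_bounds[OF irr, of k] by (simp add: t_def)
  then have "0 \<le> z mod t" "z mod t < t" by simp_all
  moreover have "inter_t x0 n (Suc k) = int n - z mod t"
    by (simp add: inter_t_def eea_step_eq_div t_def z_def minus_mod_eq_mult_div [symmetric])
  ultimately show "inter_t x0 n (Suc k) \<le> int n" "int n < eea_t x0 (Suc k) + inter_t x0 n (Suc k)"
    by (simp_all add: t_def)
qed

lemma inter_t_ge_1: "1 \<le> inter_t x0 n (Suc k)"
  using inter_t_bounds(2) bracket(1) by simp

text \<open>By the recursion, the upper bracket bound says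
  \<open>n - t_k \<le> q_(k+1) * t_(k+1)\<close>.\<close>

lemma eea_step_le: "eea_step x0 n (Suc k) \<le> eea_q x0 (Suc k)"
proof -
  have t: "0 < eea_t x0 (Suc k)" using eea_t_bounds[OF irr, of k] by simp
  have "(int n - eea_t x0 k) div eea_t x0 (Suc k)
      \<le> (eea_q x0 (Suc k) * eea_t x0 (Suc k)) div eea_t x0 (Suc k)"
    using bracket(2) t by (intro zdiv_mono1) simp_all
  then show ?thesis using t by (simp add: eea_step_eq_div)
qed

lemma inter_err_pos:
  "0 < (-1) ^ k * (of_int (inter_s x0 n (Suc k)) - of_int (inter_t x0 n (Suc k)) * x0)"
proof -
  let ?m = "eea_step x0 n (Suc k)"
  have "(-1) ^ k * (of_int (inter_s x0 n (Suc k)) - of_int (inter_t x0 n (Suc k)) * x0)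
      = eea_err x0 k - of_int ?m * eea_err x0 (Suc k)"
    by (simp add: inter_s_def inter_t_def eea_err_def algebra_simps)
  \<comment> \<open>The second summand vanishes when the step equals the full quotient, so
    strictness has to come from the first.\<close>
  also have "\<dots> = eea_err x0 (Suc (Suc k)) + of_int (eea_q x0 (Suc k) - ?m) * eea_err x0 (Suc k)"
    by (simp add: eea_err_Suc_Suc algebra_simps)
  also have "\<dots> > 0"
    using eea_step_le eea_err_pos[OF irr] by (intro add_pos_nonneg mult_nonneg_nonneg) (simp_all add: less_imp_le)
  finally show ?thesis .
qed

lemma inter_det:
  "inter_s x0 n (Suc k) * eea_t x0 (Suc k) - eea_s x0 (Suc k) * inter_t x0 n (Suc k) = (-1) ^ k"
  unfolding eea_det[of x0 k, symmetric] by (simp add: inter_s_def inter_t_def algebra_simps)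

end

theorem mainTheorem1:
  fixes x0 :: real and n j :: nat
  assumes "x0 \<notin> \<rat>"
    and "1 \<le> n"
    and "j = assigned_index x0 n"
  shows "(2 \<le> n \<longrightarrow> (\<exists>!i. is_bracket_index x0 n i)) \<and>
    (odd j \<longrightarrow>
      of_int (eea_s x0 j) / of_int (eea_t x0 j) < x0 \<and>
      x0 < of_int (inter_s x0 n j) / of_int (inter_t x0 n j) \<and>
      reduced_fraction (eea_s x0 j) (eea_t x0 j) \<and>
      reduced_fraction (inter_s x0 n j) (inter_t x0 n j) \<and>
      farey_neighbours n (of_int (eea_s x0 j) / of_int (eea_t x0 j))
        (of_int (inter_s x0 n j) / of_int (inter_t x0 n j))) \<and>
    (even j \<longrightarrow>
      of_int (inter_s x0 n j) / of_int (inter_t x0 n j) < x0 \<and>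
      x0 < of_int (eea_s x0 j) / of_int (eea_t x0 j) \<and>
      reduced_fraction (inter_s x0 n j) (inter_t x0 n j) \<and>
      reduced_fraction (eea_s x0 j) (eea_t x0 j) \<and>
      farey_neighbours n (of_int (inter_s x0 n j) / of_int (inter_t x0 n j))
        (of_int (eea_s x0 j) / of_int (eea_t x0 j)))"
proof -
  obtain k where k: "j = Suc k" and br: "eea_t x0 (Suc k) \<le> int n" "int n \<le> eea_t x0 (Suc (Suc k))"
    using assigned_index_bounds[OF assms(1,2)] assms(3) by metis
  define s t s' t' where defs: "s = eea_s x0 j" "t = eea_t x0 j" "s' = inter_s x0 n j" "t' = inter_t x0 n j"
  have t: "1 \<le> t" "t \<le> int n" using eea_t_bounds[OF assms(1), of k] br(1) by (simp_all add: defs k)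
  have t': "1 \<le> t'" "t' \<le> int n"
    using inter_t_ge_1[OF assms(1) br] inter_t_bounds[OF assms(1) br] by (simp_all add: defs k)
  have sum: "int n < t + t'" using inter_t_bounds[OF assms(1) br] by (simp add: defs k)
  have det: "s' * t - s * t' = (-1) ^ k" using inter_det[OF assms(1) br] by (simp add: defs k)
  \<comment> \<open>The sign at index \<open>j = Suc k\<close> is written through
    \<open>(-1) ^ k\<close>, so that the parity of \<open>k\<close> settles \<open>det\<close>,
    \<open>err\<close> and \<open>err'\<close> together.\<close>
  have err: "0 < - ((-1) ^ k * (of_int s - of_int t * x0))"
    using eea_err_pos[OF assms(1), of "Suc k"] by (simp add: eea_err_def defs k)
  have err': "0 < (-1) ^ k * (of_int s' - of_int t' * x0)"
    using inter_err_pos[OF assms(1) br] by (simp add: defs k)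
  have "of_int s / of_int t < x0 \<and> x0 < of_int s' / of_int t' \<and>
      reduced_fraction s t \<and> reduced_fraction s' t' \<and>
      farey_neighbours n (of_int s / of_int t) (of_int s' / of_int t')" if "odd j"
  proof -
    have "even k" using that k by simp
    then have *: "s' * t - s * t' = 1" "of_int s < of_int t * x0" "of_int t' * x0 < of_int s'"
      using det err err' by simp_all
    have frac: "of_int s / of_int t < x0" "x0 < of_int s' / of_int t'"
      using *(2,3) t(1) t'(1) by (simp_all add: pos_divide_less_eq pos_less_divide_eq mult.commute)
    then show ?thesis
      using reduced_fraction_of_det[OF *(1)] farey_neighbours_of_det[OF *(1)] t t' sum
      by (intro conjI) (simp_all only: frac add.commute)
  qed
  moreover have "of_int s' / of_int t' < x0 \<and> x0 < of_int s / of_int t \<and>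
      reduced_fraction s' t' \<and> reduced_fraction s t \<and>
      farey_neighbours n (of_int s' / of_int t') (of_int s / of_int t)" if "even j"
  proof -
    have "odd k" using that k by simp
    \<comment> \<open>For odd \<open>k\<close> the determinant is -1, so the two fractions exchange
      roles.\<close>
    then have *: "s * t' - s' * t = 1" "of_int t * x0 < of_int s" "of_int s' < of_int t' * x0"
      using det err err' by simp_all
    have frac: "of_int s' / of_int t' < x0" "x0 < of_int s / of_int t"
      using *(2,3) t(1) t'(1) by (simp_all add: pos_divide_less_eq pos_less_divide_eq mult.commute)
    then show ?thesis
      using reduced_fraction_of_det[OF *(1)] farey_neighbours_of_det[OF *(1)] t t' sum
      by (intro conjI) (simp_all only: frac add.commute)
  qed
  ultimately show ?thesis
    unfolding defs by (intro conjI impI ex1_bracket_index[OF assms(1)]) simp_all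
qed

end
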